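(* Let $k>1$ be an integer and let $\widetilde{\mathbb{Z}}$ be a ring elementarily equivalent to $\mathbb{Z}$. Then the group $BS(1,k,\widetilde{\mathbb{Z}})$ is a $\widetilde{\mathbb{Z}}$-group, i.e. it admits an exponentiation $G\times\widetilde{\mathbb{Z}}\to G$, $(g,\alpha)\mapsto g^\alpha$, satisfying: (1) $g^1=g$, $g^0=e$ for all $g$, and $e^\alpha=e$ for all $\alpha$; (2) $g^{\alpha+\beta}=g^\alpha g^\beta$ and $g^{\alpha\beta}=(g^\alpha)^\beta$ for all $g,\alpha,\beta$; (3) $(h^{-1}gh)^\alpha=h^{-1}g^\alpha h$ for all $g,h,\alpha$; (4) if $gh=hg$ then $(gh)^\alpha=g^\alpha h^\alpha$.
   Context: Let $\widetilde{\mathbb{Z}}\equiv\mathbb{Z}$ in the ring language $\{+,\cdot,0,1\}$. The standard integers embed in $\widetilde{\mathbb{Z}}$; the formula defining the positive integers (via Lagrange's four-square theorem) defines $\widetilde{\mathbb{Z}}^+$ and an order on $\widetilde{\mathbb{Z}}$. The first-order formula defining in $\mathbb{Z}$ the exponentiation $x=y^z$ ($z\ge 0$) defines in $\widetilde{\mathbb{Z}}$ an exponentiation; in particular for the integer $k$ and $i\in\widetilde{\mathbb{Z}}$, $i\ge0$, there is a unique $k^i\in\widetilde{\mathbb{Z}}$, with $k^0=1$, $k^{i_1}k^{i_2}=k^{i_1+i_2}$. Let $S=\{k^i: i\in\widetilde{\mathbb{Z}}^+\}\cup\{1\}$ and let $\widetilde{\mathbb{Z}}[1/k^{\widetilde{\mathbb{Z}}}]=S^{-1}\widetilde{\mathbb{Z}}$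 be the ring of fractions; write $k^{-i}=1/k^i$, so $k^i$ is defined for all $i\in\widetilde{\mathbb{Z}}$. Define $BS(1,k,\widetilde{\mathbb{Z}})=\widetilde{\mathbb{Z}}[1/k^{\widetilde{\mathbb{Z}}}]\rtimes\widetilde{\mathbb{Z}}$ (additive groups), i.e. the set of pairs $(x,m)$ with $x\in\widetilde{\mathbb{Z}}[1/k^{\widetilde{\mathbb{Z}}}]$, $m\in\widetilde{\mathbb{Z}}$, and product $(x_1,m_1)(x_2,m_2)=(x_1+x_2k^{-m_1},\,m_1+m_2)$. *)

theory Defs
  imports "HOL-Algebra.Group"
begin

datatype rtm = RVar nat | RZero | ROne | RAdd rtm rtm | RMul rtm rtm
datatype rfm = REq rtm rtm | RNot rfm | RAnd rfm rfm | RExists nat rfm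

primrec rtm_eval :: "(nat \<Rightarrow> 'a::comm_ring_1) \<Rightarrow> rtm \<Rightarrow> 'a" where
  "rtm_eval e (RVar n) = e n"
| "rtm_eval e RZero = 0"
| "rtm_eval e ROne = 1"
| "rtm_eval e (RAdd s t) = rtm_eval e s + rtm_eval e t"
| "rtm_eval e (RMul s t) = rtm_eval e s * rtm_eval e t"

primrec rfm_sat :: "(nat \<Rightarrow> 'a::comm_ring_1) \<Rightarrow> rfm \<Rightarrow> bool" where
  "rfm_sat e (REq s t) = (rtm_eval e s = rtm_eval e t)"
| "rfm_sat e (RNot p) = (\<not> rfm_sat e p)"
| "rfm_sat e (RAnd p q) = (rfm_sat e p \<and> rfm_sat e q)"
| "rfm_sat e (RExists x p) = (\<exists>a. rfm_sat (e(x := a)) p)"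

primrec rtm_vars :: "rtm \<Rightarrow> nat set" where
  "rtm_vars (RVar n) = {n}"
| "rtm_vars RZero = {}"
| "rtm_vars ROne = {}"
| "rtm_vars (RAdd s t) = rtm_vars s \<union> rtm_vars t"
| "rtm_vars (RMul s t) = rtm_vars s \<union> rtm_vars t"

primrec rfm_fv :: "rfm \<Rightarrow> nat set" where
  "rfm_fv (REq s t) = rtm_vars s \<union> rtm_vars t"
| "rfm_fv (RNot p) = rfm_fv p"
| "rfm_fv (RAnd p q) = rfm_fv p \<union> rfm_fv q"
| "rfm_fv (RExists x p) = rfm_fv p - {x}"

definition rsentence :: "rfm \<Rightarrow> bool" where
  "rsentence p \<longleftrightarrow> rfm_fv p = {}"

definition elem_equiv_Z :: "'a::comm_ring_1 itself \<Rightarrow> bool" where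
  "elem_equiv_Z (_::'a itself) \<longleftrightarrow>
     (\<forall>p. rsentence p \<longrightarrow>
        ((\<forall>e::nat \<Rightarrow> 'a. rfm_sat e p) \<longleftrightarrow> (\<forall>e::nat \<Rightarrow> int. rfm_sat e p)))"

definition env3 :: "'a \<Rightarrow> 'a \<Rightarrow> 'a \<Rightarrow> nat \<Rightarrow> 'a" where
  "env3 x y z = (\<lambda>n. if n = 0 then x else if n = 1 then y else z)"

definition defines_exp_Z :: "rfm \<Rightarrow> bool" where
  "defines_exp_Z p \<longleftrightarrow> rfm_fv p \<subseteq> {0,1,2} \<and>
     (\<forall>x y z :: int. rfm_sat (env3 x y z) p \<longleftrightarrow> (0 \<le> z \<and> x = y ^ nat z))"

text \<open>Non-negativity in Z~, given by the (Lagrange four squares) formula.\<close>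
definition nonneg_t :: "'a::comm_ring_1 \<Rightarrow> bool" where
  "nonneg_t a \<longleftrightarrow> (\<exists>b c d f. a = b*b + c*c + d*d + f*f)"

definition kpow :: "rfm \<Rightarrow> int \<Rightarrow> 'a::comm_ring_1 \<Rightarrow> 'a" where
  "kpow p k i = (THE x. rfm_sat (env3 x (of_int k) i) p)"

text \<open>A pair (a,i) with i >= 0 represents a / k^i.\<close>
definition frac_reps :: "('a::comm_ring_1 \<times> 'a) set" where
  "frac_reps = {(a, i). nonneg_t i}"

definition frac_rel :: "rfm \<Rightarrow> int \<Rightarrow> 'a::comm_ring_1 \<times> 'a \<Rightarrow> 'a \<times> 'a \<Rightarrow> bool" where
  "frac_rel p k q r = (case q of (a, i) \<Rightarrow> case r of (b, j) \<Rightarrow>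
      \<exists>u. nonneg_t u \<and> kpow p k u * (a * kpow p k j - b * kpow p k i) = 0)"

definition frac_class :: "rfm \<Rightarrow> int \<Rightarrow> 'a::comm_ring_1 \<times> 'a \<Rightarrow> ('a \<times> 'a) set" where
  "frac_class p k q = {r \<in> frac_reps. frac_rel p k q r}"

definition fracs :: "rfm \<Rightarrow> int \<Rightarrow> ('a::comm_ring_1 \<times> 'a) set set" where
  "fracs p k = frac_class p k ` frac_reps"

definition frac_add :: "rfm \<Rightarrow> int \<Rightarrow> ('a::comm_ring_1 \<times> 'a) set \<Rightarrow> ('a \<times> 'a) set \<Rightarrow> ('a \<times> 'a) set" where
  "frac_add p k X Y = {r \<in> frac_reps. \<exists>a i b j. (a, i) \<in> X \<and> (b, j) \<in> Y \<and>
      frac_rel p k (a * kpow p k j + b * kpow p k i, i + j) r}"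

text \<open>Multiplication of a fraction by k^(-m), m in Z~.\<close>
definition frac_scale :: "rfm \<Rightarrow> int \<Rightarrow> 'a::comm_ring_1 \<Rightarrow> ('a \<times> 'a) set \<Rightarrow> ('a \<times> 'a) set" where
  "frac_scale p k m X = {r \<in> frac_reps. \<exists>a i. (a, i) \<in> X \<and>
      (if nonneg_t m then frac_rel p k (a, i + m) r
       else frac_rel p k (a * kpow p k (- m), i) r)}"

definition BS :: "rfm \<Rightarrow> int \<Rightarrow> (('a::comm_ring_1 \<times> 'a) set \<times> 'a) monoid" where
  "BS p k = \<lparr> carrier = fracs p k \<times> UNIV,
     mult = (\<lambda>(X1, m1) (X2, m2). (frac_add p k X1 (frac_scale p k m1 X2), m1 + m2)),
     one = (frac_class p k (0, 0), 0) \<rparr>"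

definition ring_exp_group :: "('g, 'b) monoid_scheme \<Rightarrow> ('g \<Rightarrow> 'a::comm_ring_1 \<Rightarrow> 'g) \<Rightarrow> bool" where
  "ring_exp_group G pw \<longleftrightarrow> group G \<and>
    (\<forall>g\<in>carrier G. \<forall>\<alpha>. pw g \<alpha> \<in> carrier G) \<and>
    (\<forall>g\<in>carrier G. pw g 1 = g \<and> pw g 0 = \<one>\<^bsub>G\<^esub>) \<and>
    (\<forall>\<alpha>. pw \<one>\<^bsub>G\<^esub> \<alpha> = \<one>\<^bsub>G\<^esub>) \<and>
    (\<forall>g\<in>carrier G. \<forall>\<alpha> \<beta>. pw g (\<alpha> + \<beta>) = pw g \<alpha> \<otimes>\<^bsub>G\<^esub> pw g \<beta> \<and>
                          pw g (\<alpha> * \<beta>) = pw (pw g \<alpha>) \<beta>) \<and>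
    (\<forall>g\<in>carrier G. \<forall>h\<in>carrier G. \<forall>\<alpha>.
        pw (inv\<^bsub>G\<^esub> h \<otimes>\<^bsub>G\<^esub> g \<otimes>\<^bsub>G\<^esub> h) \<alpha> = inv\<^bsub>G\<^esub> h \<otimes>\<^bsub>G\<^esub> pw g \<alpha> \<otimes>\<^bsub>G\<^esub> h) \<and>
    (\<forall>g\<in>carrier G. \<forall>h\<in>carrier G. \<forall>\<alpha>.
        g \<otimes>\<^bsub>G\<^esub> h = h \<otimes>\<^bsub>G\<^esub> g \<longrightarrow> pw (g \<otimes>\<^bsub>G\<^esub> h) \<alpha> = pw g \<alpha> \<otimes>\<^bsub>G\<^esub> pw h \<alpha>)"

end

(*
  Write the elements of BS(1,k,Z~) as pairs (x, m) with x in Z~[1/k^Z~], viewed inside the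
  total ring of fractions of Z~. As for ordinary integer exponents, the power is
    (x, m)^alpha = (x (1 - k^(-alpha m)) / (1 - k^(-m)), alpha m),   and (alpha x, 0) if m = 0.
  The quotient lies in Z~[1/k^Z~] because k^s - 1 divides k^(st) - 1, and it is unique because
  Z~ has no zero divisors and k^(-m) <> 1 for m <> 0. All these facts about Z~ and its
  exponentiation are first-order sentences true in Z (nonnegativity being expressible by
  Lagrange's four-square theorem), hence true in Z~. The Z~-group axioms then become identities
  between such quotients, checked after multiplying by 1 - k^(-m).
*)
theory Submission
  imports Defs "HOL-Computational_Algebra.Primes"
begin

section \<open>Lagrange's four-square theorem\<close>

lemma euler_four_square_identity:
  fixes x1 x2 x3 x4 y1 y2 y3 y4 :: "'a::comm_ring_1"
  shows "(x1*x1 + x2*x2 + x3*x3 + x4*x4) * (y1*y1 + y2*y2 + y3*y3 + y4*y4) =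
      (x1*y1 + x2*y2 + x3*y3 + x4*y4) * (x1*y1 + x2*y2 + x3*y3 + x4*y4)
    + (x1*y2 - x2*y1 + x3*y4 - x4*y3) * (x1*y2 - x2*y1 + x3*y4 - x4*y3)
    + (x1*y3 - x3*y1 + x4*y2 - x2*y4) * (x1*y3 - x3*y1 + x4*y2 - x2*y4)
    + (x1*y4 - x4*y1 + x2*y3 - x3*y2) * (x1*y4 - x4*y1 + x2*y3 - x3*y2)"
  by (simp add: algebra_simps)

lemma nonneg_t_zero [simp]: "nonneg_t 0"
  unfolding nonneg_t_def by (rule exI[of _ 0])+ simp

lemma nonneg_t_mult: "nonneg_t a \<Longrightarrow> nonneg_t b \<Longrightarrow> nonneg_t (a * b)"
  unfolding nonneg_t_def by (metis euler_four_square_identity)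

lemma centered_residue:
  fixes m x :: int
  assumes "m > 0"
  obtains t y
  where "x = m * t + y" "4 * (y * y) \<le> m * m" "4 * (y * y) = m * m \<Longrightarrow> m = - 2 * y"
proof -
  define q where "q = m div 2"
  define y where "y = (x + q) mod m - q"
  have x: "x = m * ((x + q) div m) + y"
    unfolding y_def by (simp add: algebra_simps)
  have y: "- q \<le> y" "y < m - q" "m - 1 \<le> 2 * q" "2 * q \<le> m"
    using assms unfolding y_def q_def by auto
  then have abs_y: "2 * \<bar>y\<bar> \<le> m" by linarith
  have sq: "4 * (y * y) = (2 * \<bar>y\<bar>) * (2 * \<bar>y\<bar>)" by (simp add: abs_mult_self_eq algebra_simps)
  have "4 * (y * y) \<le> m * m" unfolding sq using mult_mono[OF abs_y abs_y] assms by simp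
  moreover have "m = - 2 * y" if "4 * (y * y) = m * m"
  proof -
    have "(2 * \<bar>y\<bar> - m) * (2 * \<bar>y\<bar> + m) = 0" using that sq by (simp add: algebra_simps)
    moreover have "2 * \<bar>y\<bar> + m > 0" using assms by simp
    ultimately have "2 * \<bar>y\<bar> = m" by simp
    then show ?thesis using y by (cases "y \<ge> 0") auto
  qed
  ultimately show ?thesis using that x by blast
qed

lemma four_squares_descent_step:
  fixes m p r x1 x2 x3 x4 t1 t2 t3 t4 y1 y2 y3 y4 :: int
  assumes "m \<noteq> 0"
    and "m * p = x1*x1 + x2*x2 + x3*x3 + x4*x4" and "m * r = y1*y1 + y2*y2 + y3*y3 + y4*y4"
    and "x1 = m * t1 + y1" "x2 = m * t2 + y2" "x3 = m * t3 + y3" "x4 = m * t4 + y4"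
  shows "nonneg_t (r * p)"
proof -
  define w1 where "w1 = p - (x1*t1 + x2*t2 + x3*t3 + x4*t4)"
  define w2 where "w2 = x2*t1 - x1*t2 + x4*t3 - x3*t4"
  define w3 where "w3 = x3*t1 - x1*t3 + x2*t4 - x4*t2"
  define w4 where "w4 = x4*t1 - x1*t4 + x3*t2 - x2*t3"
  \<comment> \<open>Since \<open>y\<^sub>i \<equiv> x\<^sub>i (mod m)\<close>, all four terms of Euler's identity for \<open>(m p)(m r)\<close>
    are divisible by \<open>m\<close>.\<close>
  have "x1*y1 + x2*y2 + x3*y3 + x4*y4
      = (x1*x1 + x2*x2 + x3*x3 + x4*x4) - m * (x1*t1 + x2*t2 + x3*t3 + x4*t4)"
    using assms(4-7) by (simp add: algebra_simps)
  then have z1: "x1*y1 + x2*y2 + x3*y3 + x4*y4 = m * w1"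
    unfolding w1_def assms(2)[symmetric] by (simp add: algebra_simps)
  have z2: "x1*y2 - x2*y1 + x3*y4 - x4*y3 = m * w2"
    and z3: "x1*y3 - x3*y1 + x4*y2 - x2*y4 = m * w3"
    and z4: "x1*y4 - x4*y1 + x2*y3 - x3*y2 = m * w4"
    unfolding w2_def w3_def w4_def using assms(4-7) by (simp_all add: algebra_simps)
  have "(m * p) * (m * r) = (m*w1) * (m*w1) + (m*w2) * (m*w2) + (m*w3) * (m*w3) + (m*w4) * (m*w4)"
    unfolding assms(2,3) z1[symmetric] z2[symmetric] z3[symmetric] z4[symmetric]
    by (rule euler_four_square_identity)
  then have "(m * m) * (r * p) = (m * m) * (w1*w1 + w2*w2 + w3*w3 + w4*w4)"
    by (simp add: algebra_simps)
  then show ?thesis using assms(1) unfolding nonneg_t_def by auto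
qed

lemma four_squares_descent:
  fixes p m :: int
  assumes p: "prime p" and m: "1 < m" "m < p" and mp: "nonneg_t (m * p)"
  shows "\<exists>r. 0 < r \<and> r < m \<and> nonneg_t (r * p)"
proof -
  obtain x1 x2 x3 x4 where x: "m * p = x1*x1 + x2*x2 + x3*x3 + x4*x4"
    using mp unfolding nonneg_t_def by blast
  have m0: "m > 0" using m by simp
  obtain t1 y1 where 1: "x1 = m * t1 + y1" "4 * (y1 * y1) \<le> m * m"
      "4 * (y1 * y1) = m * m \<Longrightarrow> m = - 2 * y1"
    using centered_residue[OF m0, of x1] by blast
  obtain t2 y2 where 2: "x2 = m * t2 + y2" "4 * (y2 * y2) \<le> m * m"
      "4 * (y2 * y2) = m * m \<Longrightarrow> m = - 2 * y2"
    using centered_residue[OF m0, of x2] by blast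
  obtain t3 y3 where 3: "x3 = m * t3 + y3" "4 * (y3 * y3) \<le> m * m"
      "4 * (y3 * y3) = m * m \<Longrightarrow> m = - 2 * y3"
    using centered_residue[OF m0, of x3] by blast
  obtain t4 y4 where 4: "x4 = m * t4 + y4" "4 * (y4 * y4) \<le> m * m"
      "4 * (y4 * y4) = m * m \<Longrightarrow> m = - 2 * y4"
    using centered_residue[OF m0, of x4] by blast
  define r where
    "r = p - 2 * (x1*t1 + x2*t2 + x3*t3 + x4*t4) + m * (t1*t1 + t2*t2 + t3*t3 + t4*t4)"
  have mr: "m * r = y1*y1 + y2*y2 + y3*y3 + y4*y4"
  proof -
    have "m * r = m * p - 2 * m * (x1*t1 + x2*t2 + x3*t3 + x4*t4)
        + m * m * (t1*t1 + t2*t2 + t3*t3 + t4*t4)"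
      unfolding r_def by (simp add: algebra_simps)
    then show ?thesis unfolding x using 1(1) 2(1) 3(1) 4(1) by (simp add: algebra_simps)
  qed
  have "m * r \<le> m * m" using 1(2) 2(2) 3(2) 4(2) mr by linarith
  then have "r \<le> m" using m0 by simp
  moreover have "0 \<le> m * r" unfolding mr by simp
  then have "0 \<le> r" using m0 by (simp add: zero_le_mult_iff)
  moreover have ndvd: "\<not> m dvd p" using prime_int_not_dvd[OF p] m by blast
  moreover have "r \<noteq> 0"
  proof
    assume "r = 0"
    then have "y1*y1 + y2*y2 + y3*y3 + y4*y4 = 0" using mr by simp
    moreover have "0 \<le> y1*y1" "0 \<le> y2*y2" "0 \<le> y3*y3" "0 \<le> y4*y4" by simp_all
    ultimately have "y1*y1 = 0 \<and> y2*y2 = 0 \<and> y3*y3 = 0 \<and> y4*y4 = 0" by linarith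
    then have "y1 = 0 \<and> y2 = 0 \<and> y3 = 0 \<and> y4 = 0" by simp
    then have "m * p = m * (m * (t1*t1 + t2*t2 + t3*t3 + t4*t4))"
      using x 1(1) 2(1) 3(1) 4(1) by (simp add: algebra_simps)
    then show False using ndvd m0 by simp
  qed
  moreover have "r \<noteq> m"
  proof
    assume "r = m"
    \<comment> \<open>Then every \<open>y\<^sub>i\<close> equals \<open>-m/2\<close>, which makes \<open>m\<close> a divisor of \<open>p\<close>.\<close>
    then have "m * m = y1*y1 + y2*y2 + y3*y3 + y4*y4" using mr by simp
    then have "4 * (y1 * y1) = m * m" "4 * (y2 * y2) = m * m" "4 * (y3 * y3) = m * m"
        "4 * (y4 * y4) = m * m"
      using 1(2) 2(2) 3(2) 4(2) by linarith+
    then have "m = - 2 * y1" "m = - 2 * y2" "m = - 2 * y3" "m = - 2 * y4"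
      using 1(3) 2(3) 3(3) 4(3) by blast+
    then have
      "4 * (m * p) = 4 * (m * (m * (t1*t1 + t2*t2 + t3*t3 + t4*t4 - t1 - t2 - t3 - t4 + 1)))"
      using x 1(1) 2(1) 3(1) 4(1) by (simp add: algebra_simps)
    then show False using ndvd m0 by simp
  qed
  ultimately show ?thesis
    using four_squares_descent_step[OF _ x mr 1(1) 2(1) 3(1) 4(1)] m0 by (intro exI[of _ r]) auto
qed

lemma squares_mod_prime_inj_on:
  fixes p :: int
  assumes "prime p"
  shows "inj_on (\<lambda>x. (x * x) mod p) {0..(p - 1) div 2}"
proof (rule inj_onI)
  fix x x' assume x: "x \<in> {0..(p - 1) div 2}" and x': "x' \<in> {0..(p - 1) div 2}"
    and "(x * x) mod p = (x' * x') mod p"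
  then have "p dvd (x - x') * (x + x')" by (simp add: mod_eq_dvd_iff algebra_simps)
  then have "p dvd x - x' \<or> p dvd x + x'" using assms prime_dvd_mult_iff by blast
  moreover have "\<bar>x - x'\<bar> < \<bar>p\<bar>" "\<bar>x + x'\<bar> < \<bar>p\<bar>" using x x' by auto
  ultimately have "x - x' = 0 \<or> x + x' = 0" using dvd_imp_le_int by (meson not_le)
  then show "x = x'" using x x' by auto
qed

lemma prime_dvd_sum_two_squares_plus_one:
  fixes p :: int
  assumes p: "prime p" and "odd p"
  shows "\<exists>x y. 0 \<le> x \<and> x \<le> (p - 1) div 2 \<and> 0 \<le> y \<and> y \<le> (p - 1) div 2 \<and>
    p dvd x * x + y * y + 1"
proof -
  define I where "I = {0..(p - 1) div 2}"
  define A where "A = (\<lambda>x. (x * x) mod p) ` I"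
  define B where "B = (\<lambda>y. (- 1 - y * y) mod p) ` I"
  have p1: "p > 1" using p prime_gt_1_int by blast
  have inj: "inj_on (\<lambda>x. (x * x) mod p) I"
    unfolding I_def by (rule squares_mod_prime_inj_on[OF p])
  moreover have "inj_on (\<lambda>y. (- 1 - y * y) mod p) I"
  proof (rule inj_onI)
    fix y y' assume y: "y \<in> I" "y' \<in> I" and "(- 1 - y * y) mod p = (- 1 - y' * y') mod p"
    then have "p dvd y' * y' - y * y" by (simp add: mod_eq_dvd_iff)
    then have "(y * y) mod p = (y' * y') mod p" by (simp add: mod_eq_dvd_iff dvd_diff_commute)
    then show "y = y'" using inj_onD[OF inj] y by blast
  qed
  ultimately have card: "card A = card I" "card B = card I"
    unfolding A_def B_def by (simp_all add: card_image)
  have "A \<inter> B \<noteq> {}"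
  proof
    assume "A \<inter> B = {}"
    then have "int (card (A \<union> B)) = 2 * int (card I)"
      using card card_Un_disjoint[of A B] unfolding A_def B_def I_def by simp
    moreover have "A \<union> B \<subseteq> {0..<p}" unfolding A_def B_def using p1 by auto
    then have "card (A \<union> B) \<le> card {0..<p}" by (intro card_mono) simp_all
    then have "int (card (A \<union> B)) \<le> p" using p1 by simp
    moreover have "int (card I) = (p - 1) div 2 + 1" unfolding I_def using p1 by simp
    then have "p < 2 * int (card I)" using \<open>odd p\<close> by (auto elim: oddE)
    ultimately show False by linarith
  qed
  then obtain x y where xy: "x \<in> I" "y \<in> I" and "(x * x) mod p = (- 1 - y * y) mod p"
    unfolding A_def B_def by blast
  then have "p dvd x * x - (- 1 - y * y)" by (simp only: mod_eq_dvd_iff)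
  then have "p dvd x * x + y * y + 1" by (simp add: algebra_simps)
  moreover have "0 \<le> x" "x \<le> (p - 1) div 2" "0 \<le> y" "y \<le> (p - 1) div 2"
    using xy unfolding I_def by simp_all
  ultimately show ?thesis by blast
qed

lemma prime_sum_four_squares_of_multiple:
  fixes p m :: int
  assumes p: "prime p" and "0 < m" "m < p" "nonneg_t (m * p)"
  shows "nonneg_t p"
  using assms(2-4)
proof (induction "nat m" arbitrary: m rule: less_induct)
  case less
  show ?case
  proof (cases "m = 1")
    case True
    then show ?thesis using less.prems by simp
  next
    case False
    then obtain r where "0 < r" "r < m" "nonneg_t (r * p)"
      using four_squares_descent[OF p _ less.prems(2,3)] less.prems(1) by auto
    then show ?thesis using less.hyps less.prems(2) by force
  qed
qed

lemma odd_prime_sum_four_squares: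
  fixes p :: int
  assumes p: "prime p" and "odd p"
  shows "nonneg_t p"
proof -
  obtain x y where xy: "0 \<le> x" "x \<le> (p - 1) div 2" "0 \<le> y" "y \<le> (p - 1) div 2"
    and "p dvd x * x + y * y + 1"
    using prime_dvd_sum_two_squares_plus_one[OF assms] by blast
  then obtain m where m: "x * x + y * y + 1 = p * m" by blast
  have p1: "p > 1" using p prime_gt_1_int by blast
  have "2 * x < p" "2 * y < p" using xy by auto
  then have "(2 * x) * (2 * x) < p * p" "(2 * y) * (2 * y) < p * p"
    using mult_strict_mono[of "2 * x" p "2 * x" p] mult_strict_mono[of "2 * y" p "2 * y" p] xy(1,3)
    by auto
  moreover have "2 * p \<le> p * p" using mult_right_mono[of 2 p p] p1 by simp
  moreover have "4 * (p * m) = 4 * (x * x) + 4 * (y * y) + 4" using m by simp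
  ultimately have "p * m < p * p" using p1 by linarith
  then have "m < p" using p1 by simp
  moreover have "0 < p * m"
    using m by (metis add_pos_nonneg zero_less_one sum_squares_ge_zero add.commute)
  then have "0 < m" using p1 by (simp add: zero_less_mult_iff)
  moreover have "m * p = x * x + y * y + 1 * 1 + 0 * 0" using m by simp
  then have "nonneg_t (m * p)" unfolding nonneg_t_def by blast
  ultimately show ?thesis using prime_sum_four_squares_of_multiple[OF p] by blast
qed

lemma prime_sum_four_squares:
  fixes p :: int
  assumes "prime p"
  shows "nonneg_t p"
proof (cases "p = 2")
  case True
  then have "p = 1 * 1 + 1 * 1 + 0 * 0 + 0 * 0" by simp
  then show ?thesis unfolding nonneg_t_def by blast
next
  case False
  then have "odd p" using assms prime_ge_2_int[OF assms] by (intro prime_odd_int) auto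
  then show ?thesis using odd_prime_sum_four_squares[OF assms] by blast
qed

lemma int_nonneg_sum_four_squares:
  fixes n :: int
  assumes "0 \<le> n"
  shows "nonneg_t n"
  using assms
proof (induction "nat n" arbitrary: n rule: less_induct)
  case less
  show ?case
  proof (cases "n \<le> 1")
    case True
    then have "n = n * n + 0 * 0 + 0 * 0 + 0 * 0" using less.prems by auto
    then show ?thesis unfolding nonneg_t_def by blast
  next
    case False
    then obtain q where q: "prime q" "q dvd n" using prime_divisor_exists[of n] less.prems by auto
    then obtain c where c: "n = q * c" by blast
    have "q > 1" using q(1) prime_gt_1_int by blast
    moreover have "0 < q * c" using c False by simp
    ultimately have "0 < c" "c < n" using c by (simp_all add: zero_less_mult_iff)
    then have "nonneg_t c" using less.hyps by force
    then show ?thesis unfolding c using prime_sum_four_squares[OF q(1)] nonneg_t_mult by blast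
  qed
qed

lemma nonneg_t_int_iff: "nonneg_t (n :: int) \<longleftrightarrow> 0 \<le> n"
proof
  assume "nonneg_t n"
  then show "0 \<le> n" unfolding nonneg_t_def by (auto intro!: add_nonneg_nonneg)
qed (rule int_nonneg_sum_four_squares)

section \<open>First-order formulas over rings\<close>

lemma rtm_eval_cong: "\<forall>v\<in>rtm_vars t. e v = e' v \<Longrightarrow> rtm_eval e t = rtm_eval e' t"
  by (induction t) auto

lemma rfm_sat_cong: "\<forall>v\<in>rfm_fv f. e v = e' v \<Longrightarrow> rfm_sat e f = rfm_sat e' f"
proof (induction f arbitrary: e e')
  case (REq s t)
  then show ?case using rtm_eval_cong[of s e e'] rtm_eval_cong[of t e e'] by simp
next
  case (RNot f)
  then show ?case by simp
next
  case (RAnd f g)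
  have "rfm_sat e f = rfm_sat e' f" "rfm_sat e g = rfm_sat e' g"
    using RAnd.prems by (intro RAnd.IH; auto)+
  then show ?case by simp
next
  case (RExists x f)
  have "rfm_sat (e(x := a)) f = rfm_sat (e'(x := a)) f" for a
    using RExists.prems by (intro RExists.IH) auto
  then show ?case by simp
qed

definition rfm_all :: "nat \<Rightarrow> rfm \<Rightarrow> rfm" where
  "rfm_all x f = RNot (RExists x (RNot f))"

definition rfm_imp :: "rfm \<Rightarrow> rfm \<Rightarrow> rfm" where
  "rfm_imp f g = RNot (RAnd f (RNot g))"

definition rfm_or :: "rfm \<Rightarrow> rfm \<Rightarrow> rfm" where
  "rfm_or f g = RNot (RAnd (RNot f) (RNot g))"

lemma rfm_sat_all [simp]: "rfm_sat e (rfm_all x f) \<longleftrightarrow> (\<forall>a. rfm_sat (e(x := a)) f)"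
  by (simp add: rfm_all_def)

lemma rfm_sat_imp [simp]: "rfm_sat e (rfm_imp f g) \<longleftrightarrow> (rfm_sat e f \<longrightarrow> rfm_sat e g)"
  by (simp add: rfm_imp_def)

lemma rfm_sat_or [simp]: "rfm_sat e (rfm_or f g) \<longleftrightarrow> rfm_sat e f \<or> rfm_sat e g"
  by (simp add: rfm_or_def)

lemma rfm_fv_all [simp]: "rfm_fv (rfm_all x f) = rfm_fv f - {x}"
  by (simp add: rfm_all_def)

lemma rfm_fv_imp [simp]: "rfm_fv (rfm_imp f g) = rfm_fv f \<union> rfm_fv g"
  by (simp add: rfm_imp_def)

lemma rfm_fv_or [simp]: "rfm_fv (rfm_or f g) = rfm_fv f \<union> rfm_fv g"
  by (simp add: rfm_or_def)

primrec rtm_of_nat :: "nat \<Rightarrow> rtm" where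
  "rtm_of_nat 0 = RZero"
| "rtm_of_nat (Suc n) = RAdd (rtm_of_nat n) ROne"

lemma rtm_eval_of_nat [simp]: "rtm_eval e (rtm_of_nat n) = of_nat n"
  by (induction n) auto

lemma rtm_vars_of_nat [simp]: "rtm_vars (rtm_of_nat n) = {}"
  by (induction n) auto

text \<open>The formula \<open>p\<close>, whose free variables are among \<open>0, 1, 2\<close>, applied to the terms
  \<open>a, b, c\<close>; these must not mention the variables \<open>0, 1, 2\<close>.\<close>
definition rfm_at :: "rfm \<Rightarrow> rtm \<Rightarrow> rtm \<Rightarrow> rtm \<Rightarrow> rfm" where
  "rfm_at p a b c = RExists 0 (RExists 1 (RExists 2
     (RAnd (REq (RVar 0) a) (RAnd (REq (RVar 1) b) (RAnd (REq (RVar 2) c) p)))))"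

lemma rfm_fv_at [simp]:
  "rfm_fv p \<subseteq> {0, 1, 2} \<Longrightarrow>
    rfm_fv (rfm_at p a b c) = (rtm_vars a \<union> rtm_vars b \<union> rtm_vars c) - {0, 1, 2}"
  unfolding rfm_at_def by auto

lemma rfm_sat_at [simp]:
  assumes "rfm_fv p \<subseteq> {0, 1, 2}"
    and "rtm_vars a \<inter> {0, 1, 2} = {}" "rtm_vars b \<inter> {0, 1, 2} = {}" "rtm_vars c \<inter> {0, 1, 2} = {}"
  shows "rfm_sat e (rfm_at p a b c) \<longleftrightarrow>
    rfm_sat (env3 (rtm_eval e a) (rtm_eval e b) (rtm_eval e c)) p"
proof -
  have eval: "rtm_eval (e(0 := x, 1 := y, 2 := z)) t = rtm_eval e t"
    if "rtm_vars t \<inter> {0, 1, 2} = {}" for t x y z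
    using that by (intro rtm_eval_cong) auto
  have "rfm_sat (e(0 := x, 1 := y, 2 := z)) p = rfm_sat (env3 x y z) p" for x y z
    using assms(1) by (intro rfm_sat_cong) (auto simp: env3_def)
  then show ?thesis unfolding rfm_at_def using eval[OF assms(2)] eval[OF assms(3)] eval[OF assms(4)]
    by simp
qed

text \<open>\<open>rfm_nonneg t\<close> and \<open>rfm_nonpos t\<close> express \<open>nonneg_t t\<close> and \<open>nonneg_t (- t)\<close>
  (the language has no negation); \<open>t\<close> must not mention the variables \<open>10, \<dots>, 13\<close>.\<close>
definition rfm_nonneg :: "rtm \<Rightarrow> rfm" where
  "rfm_nonneg t = RExists 10 (RExists 11 (RExists 12 (RExists 13 (REq t
     (RAdd (RAdd (RAdd (RMul (RVar 10) (RVar 10)) (RMul (RVar 11) (RVar 11)))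
        (RMul (RVar 12) (RVar 12))) (RMul (RVar 13) (RVar 13)))))))"

definition rfm_nonpos :: "rtm \<Rightarrow> rfm" where
  "rfm_nonpos t = RExists 10 (RExists 11 (RExists 12 (RExists 13 (REq RZero (RAdd t
     (RAdd (RAdd (RAdd (RMul (RVar 10) (RVar 10)) (RMul (RVar 11) (RVar 11)))
        (RMul (RVar 12) (RVar 12))) (RMul (RVar 13) (RVar 13))))))))"

lemma rfm_fv_nonneg [simp]: "rfm_fv (rfm_nonneg t) = rtm_vars t - {10, 11, 12, 13}"
  unfolding rfm_nonneg_def by auto

lemma rfm_fv_nonpos [simp]: "rfm_fv (rfm_nonpos t) = rtm_vars t - {10, 11, 12, 13}"
  unfolding rfm_nonpos_def by auto

lemma rfm_sat_nonneg [simp]: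
  assumes "rtm_vars t \<inter> {10, 11, 12, 13} = {}"
  shows "rfm_sat e (rfm_nonneg t) \<longleftrightarrow> nonneg_t (rtm_eval e t)"
proof -
  have "rtm_eval (e(10 := a, 11 := b, 12 := c, 13 := d)) t = rtm_eval e t" for a b c d
    using assms by (intro rtm_eval_cong) auto
  then show ?thesis unfolding rfm_nonneg_def nonneg_t_def by simp
qed

lemma rfm_sat_nonpos [simp]:
  assumes "rtm_vars t \<inter> {10, 11, 12, 13} = {}"
  shows "rfm_sat e (rfm_nonpos t) \<longleftrightarrow> nonneg_t (- rtm_eval e t)"
proof -
  have "rtm_eval (e(10 := a, 11 := b, 12 := c, 13 := d)) t = rtm_eval e t" for a b c d
    using assms by (intro rtm_eval_cong) auto
  moreover have "0 = x + s \<longleftrightarrow> - x = s" for x s :: 'a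
    by (metis add.commute add_eq_0_iff minus_unique)
  ultimately show ?thesis unfolding rfm_nonpos_def nonneg_t_def by simp
qed

lemma elem_equiv_Z_sat:
  assumes "elem_equiv_Z TYPE('a::comm_ring_1)" and "rsentence f"
    and "\<And>e :: nat \<Rightarrow> int. rfm_sat e f"
  shows "rfm_sat (e :: nat \<Rightarrow> 'a) f"
  using assms unfolding elem_equiv_Z_def by blast

section \<open>The total ring of fractions\<close>

definition non_zero_divisor :: "'a::comm_ring_1 \<Rightarrow> bool" where
  "non_zero_divisor b \<longleftrightarrow> (\<forall>x. x * b = 0 \<longrightarrow> x = 0)"

lemma non_zero_divisor_one [simp]: "non_zero_divisor 1"
  by (simp add: non_zero_divisor_def)

lemma non_zero_divisor_mult:
  "non_zero_divisor b \<Longrightarrow> non_zero_divisor d \<Longrightarrow> non_zero_divisor (b * d)"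
  unfolding non_zero_divisor_def by (metis mult.assoc)

lemma non_zero_divisor_cancel: "non_zero_divisor b \<Longrightarrow> b * x = b * y \<Longrightarrow> x = y"
  unfolding non_zero_divisor_def by (metis eq_iff_diff_eq_0 mult.commute right_diff_distrib)

definition tfract_rel :: "'a::comm_ring_1 \<times> 'a \<Rightarrow> 'a \<times> 'a \<Rightarrow> bool" where
  "tfract_rel x y \<longleftrightarrow>
     non_zero_divisor (snd x) \<and> non_zero_divisor (snd y) \<and> fst x * snd y = fst y * snd x"

lemmas tfract_rel_iff [simp] = tfract_rel_def

lemma part_equivp_tfract_rel: "part_equivp (tfract_rel :: 'a::comm_ring_1 \<times> 'a \<Rightarrow> _)"
proof (rule part_equivpI)
  show "\<exists>x::'a \<times> 'a. tfract_rel x x" by (rule exI[of _ "(0, 1)"]) simp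
  show "symp (tfract_rel :: 'a \<times> 'a \<Rightarrow> _)" by (auto simp: symp_def)
  show "transp (tfract_rel :: 'a \<times> 'a \<Rightarrow> _)"
  proof (rule transpI, unfold split_paired_all)
    fix a b a' b' a'' b'' :: 'a
    assume A: "tfract_rel (a, b) (a', b')" and B: "tfract_rel (a', b') (a'', b'')"
    have "b' * (a * b'') = b'' * (a * b')" by (simp add: ac_simps)
    also from A have "a * b' = a' * b" by auto
    also have "b'' * (a' * b) = b * (a' * b'')" by (simp add: ac_simps)
    also from B have "a' * b'' = a'' * b'" by auto
    also have "b * (a'' * b') = b' * (a'' * b)" by (simp add: ac_simps)
    finally have "b' * (a * b'') = b' * (a'' * b)" .
    then have "a * b'' = a'' * b" using B non_zero_divisor_cancel by auto
    with A B show "tfract_rel (a, b) (a'', b'')" by auto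
  qed
qed

text \<open>The total ring of fractions, i.e. \<open>'a\<close> localized at its non-zero-divisors. Unlike
  \<open>'a fract\<close> from \<open>HOL-Computational_Algebra.Fraction_Field\<close> it needs no \<open>idom\<close> instance:
  below, \<open>'a\<close> is a domain only by elementary equivalence with \<open>\<int>\<close>.\<close>
quotient_type (overloaded) 'a tfract = "'a::comm_ring_1 \<times> 'a" / partial: "tfract_rel"
  by (rule part_equivp_tfract_rel)

lift_definition TFract :: "'a::comm_ring_1 \<Rightarrow> 'a \<Rightarrow> 'a tfract"
  is "\<lambda>a b. if non_zero_divisor b then (a, b) else (0, 1)"
  by simp

lemma TFract_cases:
  obtains a b where "q = TFract a b" "non_zero_divisor b"
  by transfer auto

lemma eq_tfract:
  "non_zero_divisor b \<Longrightarrow> non_zero_divisor d \<Longrightarrow> TFract a b = TFract c d \<longleftrightarrow> a * d = c * b"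
  by transfer simp

instantiation tfract :: (comm_ring_1) comm_ring_1
begin

lift_definition zero_tfract :: "'a tfract" is "(0, 1)" by simp

lemma Zero_tfract_def: "0 = TFract 0 1"
  by transfer simp

lift_definition one_tfract :: "'a tfract" is "(1, 1)" by simp

lemma One_tfract_def: "1 = TFract 1 1"
  by transfer simp

lift_definition plus_tfract :: "'a tfract \<Rightarrow> 'a tfract \<Rightarrow> 'a tfract"
  is "\<lambda>q r. (fst q * snd r + fst r * snd q, snd q * snd r)"
  by (auto simp: non_zero_divisor_mult algebra_simps) (metis mult.assoc mult.commute)

lemma add_tfract [simp]:
  "non_zero_divisor b \<Longrightarrow> non_zero_divisor d \<Longrightarrow>
    TFract a b + TFract c d = TFract (a * d + c * b) (b * d)"
  by transfer (simp add: non_zero_divisor_mult)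

lift_definition uminus_tfract :: "'a tfract \<Rightarrow> 'a tfract" is "\<lambda>x. (- fst x, snd x)"
  by simp

lemma minus_tfract [simp]: "non_zero_divisor b \<Longrightarrow> - TFract a b = TFract (- a) b"
  by transfer simp

definition diff_tfract_def: "q - r = q + - (r::'a tfract)"

lift_definition times_tfract :: "'a tfract \<Rightarrow> 'a tfract \<Rightarrow> 'a tfract"
  is "\<lambda>q r. (fst q * fst r, snd q * snd r)"
  by (auto simp: non_zero_divisor_mult) (metis mult.assoc mult.commute)

lemma mult_tfract [simp]:
  "non_zero_divisor b \<Longrightarrow> non_zero_divisor d \<Longrightarrow> TFract a b * TFract c d = TFract (a * c) (b * d)"
  by transfer (simp add: non_zero_divisor_mult)

instance
proof
  fix q r s :: "'a tfract"
  show "(q * r) * s = q * (r * s)"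
    by (cases q rule: TFract_cases, cases r rule: TFract_cases, cases s rule: TFract_cases)
       (simp add: eq_tfract non_zero_divisor_mult algebra_simps)
  show "q * r = r * q"
    by (cases q rule: TFract_cases, cases r rule: TFract_cases)
       (simp add: eq_tfract non_zero_divisor_mult algebra_simps)
  show "1 * q = q"
    by (cases q rule: TFract_cases) (simp add: One_tfract_def eq_tfract)
  show "(q + r) + s = q + (r + s)"
    by (cases q rule: TFract_cases, cases r rule: TFract_cases, cases s rule: TFract_cases)
       (simp add: eq_tfract non_zero_divisor_mult algebra_simps)
  show "q + r = r + q"
    by (cases q rule: TFract_cases, cases r rule: TFract_cases)
       (simp add: eq_tfract non_zero_divisor_mult algebra_simps)
  show "0 + q = q"
    by (cases q rule: TFract_cases) (simp add: Zero_tfract_def eq_tfract)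
  show "- q + q = 0"
    by (cases q rule: TFract_cases) (simp add: Zero_tfract_def eq_tfract non_zero_divisor_mult)
  show "q - r = q + - r"
    by (simp add: diff_tfract_def)
  show "(q + r) * s = q * s + r * s"
    by (cases q rule: TFract_cases, cases r rule: TFract_cases, cases s rule: TFract_cases)
       (simp add: eq_tfract non_zero_divisor_mult algebra_simps)
  show "(0::'a tfract) \<noteq> 1"
    by (simp add: Zero_tfract_def One_tfract_def eq_tfract)
qed

end

lemma diff_tfract [simp]:
  "non_zero_divisor b \<Longrightarrow> non_zero_divisor d \<Longrightarrow>
    TFract a b - TFract c d = TFract (a * d - c * b) (b * d)"
  by (simp add: diff_tfract_def)

lemma tfract_mult_eq_0_iff:
  assumes "\<And>a b :: 'a::comm_ring_1. a * b = 0 \<Longrightarrow> a = 0 \<or> b = 0"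
  shows "(x :: 'a tfract) * y = 0 \<longleftrightarrow> x = 0 \<or> y = 0"
proof -
  obtain a b where x: "x = TFract a b" "non_zero_divisor b" by (rule TFract_cases)
  obtain c d where y: "y = TFract c d" "non_zero_divisor d" by (rule TFract_cases)
  have "x * y = 0 \<longleftrightarrow> a * c = 0"
    using x y by (simp add: Zero_tfract_def eq_tfract non_zero_divisor_mult)
  also have "\<dots> \<longleftrightarrow> a = 0 \<or> c = 0" using assms by auto
  also have "\<dots> \<longleftrightarrow> x = 0 \<or> y = 0" using x y by (simp add: Zero_tfract_def eq_tfract)
  finally show ?thesis .
qed

section \<open>Facts transferred from \<open>\<int>\<close>\<close>

context
  fixes p :: rfm and k :: int
  assumes k_gt_1: "k > 1"
    and elem_equiv: "elem_equiv_Z TYPE('a::comm_ring_1)"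
    and defines_exp: "defines_exp_Z p"
begin

lemma rfm_fv_exp: "rfm_fv p \<subseteq> {0, 1, 2}"
  using defines_exp unfolding defines_exp_Z_def by blast

lemma rfm_sat_exp_int [simp]: "rfm_sat (env3 x y z) p \<longleftrightarrow> 0 \<le> z \<and> x = y ^ nat (z :: int)"
  using defines_exp unfolding defines_exp_Z_def by blast

lemmas rfm_sat_exp_at [simp] = rfm_sat_at[OF rfm_fv_exp]
  and rfm_fv_exp_at [simp] = rfm_fv_at[OF rfm_fv_exp]

lemma of_nat_nat_k [simp]: "(of_nat (nat k) :: 'b::comm_ring_1) = of_int k"
  using k_gt_1 by simp

abbreviation k_rtm :: rtm where "k_rtm \<equiv> rtm_of_nat (nat k)"

abbreviation is_kpow :: "'a \<Rightarrow> 'a \<Rightarrow> bool" where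
  "is_kpow x i \<equiv> rfm_sat (env3 x (of_int k) i) p"

lemma sat_from_int:
  "rsentence f \<Longrightarrow> (\<And>e :: nat \<Rightarrow> int. rfm_sat e f) \<Longrightarrow> rfm_sat (\<lambda>_. 0 :: 'a) f"
  by (rule elem_equiv_Z_sat[OF elem_equiv])

lemma no_zero_divisors: "(a :: 'a) * b = 0 \<Longrightarrow> a = 0 \<or> b = 0"
proof -
  have "rfm_sat (\<lambda>_. 0 :: 'a) (rfm_all 3 (rfm_all 4 (rfm_imp (REq (RMul (RVar 3) (RVar 4)) RZero)
      (rfm_or (REq (RVar 3) RZero) (REq (RVar 4) RZero)))))"
    by (rule sat_from_int) (auto simp: rsentence_def)
  then show "a * b = 0 \<Longrightarrow> a = 0 \<or> b = 0" by simp
qed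

lemma nonneg_t_cases: "nonneg_t (a :: 'a) \<or> nonneg_t (- a)"
proof -
  have "rfm_sat (\<lambda>_. 0 :: 'a) (rfm_all 3 (rfm_or (rfm_nonneg (RVar 3)) (rfm_nonpos (RVar 3))))"
    by (rule sat_from_int) (auto simp: rsentence_def nonneg_t_int_iff)
  then show ?thesis by simp
qed

lemma nonneg_t_add: "nonneg_t (a :: 'a) \<Longrightarrow> nonneg_t b \<Longrightarrow> nonneg_t (a + b)"
proof -
  have "rfm_sat (\<lambda>_. 0 :: 'a) (rfm_all 3 (rfm_all 4 (rfm_imp (rfm_nonneg (RVar 3))
      (rfm_imp (rfm_nonneg (RVar 4)) (rfm_nonneg (RAdd (RVar 3) (RVar 4)))))))"
    by (rule sat_from_int) (auto simp: rsentence_def nonneg_t_int_iff)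
  then show "nonneg_t a \<Longrightarrow> nonneg_t b \<Longrightarrow> nonneg_t (a + b)" by simp
qed

lemma is_kpow_unique: "is_kpow x i \<Longrightarrow> is_kpow y i \<Longrightarrow> x = y"
proof -
  have "rfm_sat (\<lambda>_. 0 :: 'a) (rfm_all 3 (rfm_all 4 (rfm_all 5
      (rfm_imp (rfm_at p (RVar 4) k_rtm (RVar 3))
      (rfm_imp (rfm_at p (RVar 5) k_rtm (RVar 3)) (REq (RVar 4) (RVar 5)))))))"
    by (rule sat_from_int) (auto simp: rsentence_def)
  then show "is_kpow x i \<Longrightarrow> is_kpow y i \<Longrightarrow> x = y" by simp
qed

lemma kpow_eqI: "is_kpow x i \<Longrightarrow> kpow p k i = x"
  unfolding kpow_def using is_kpow_unique by blast

lemma is_kpow_kpow: "nonneg_t i \<Longrightarrow> is_kpow (kpow p k i) i"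
proof -
  have "rfm_sat (\<lambda>_. 0 :: 'a) (rfm_all 3 (rfm_imp (rfm_nonneg (RVar 3))
      (RExists 4 (rfm_at p (RVar 4) k_rtm (RVar 3)))))"
    by (rule sat_from_int) (auto simp: rsentence_def nonneg_t_int_iff)
  then show "nonneg_t i \<Longrightarrow> is_kpow (kpow p k i) i" using kpow_eqI by force
qed

lemma kpow_zero [simp]: "kpow p k 0 = (1 :: 'a)"
proof -
  have "rfm_sat (\<lambda>_. 0 :: 'a) (rfm_at p ROne k_rtm RZero)"
    by (rule sat_from_int) (auto simp: rsentence_def)
  then show ?thesis by (intro kpow_eqI) simp
qed

lemma kpow_add:
  assumes "nonneg_t (i :: 'a)" "nonneg_t j"
  shows "kpow p k (i + j) = kpow p k i * kpow p k j"
proof -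
  have "rfm_sat (\<lambda>_. 0 :: 'a) (rfm_all 3 (rfm_all 4 (rfm_all 5 (rfm_all 6
      (rfm_imp (rfm_nonneg (RVar 3)) (rfm_imp (rfm_nonneg (RVar 4))
      (rfm_imp (rfm_at p (RVar 5) k_rtm (RVar 3)) (rfm_imp (rfm_at p (RVar 6) k_rtm (RVar 4))
      (rfm_at p (RMul (RVar 5) (RVar 6)) k_rtm (RAdd (RVar 3) (RVar 4)))))))))))"
    by (rule sat_from_int) (auto simp: rsentence_def nonneg_t_int_iff nat_add_distrib power_add)
  then show ?thesis using assms is_kpow_kpow by (intro kpow_eqI) simp
qed

lemma kpow_nonzero: "nonneg_t i \<Longrightarrow> kpow p k i \<noteq> (0 :: 'a)"
proof -
  have "rfm_sat (\<lambda>_. 0 :: 'a) (rfm_all 3 (rfm_imp (rfm_nonneg (RVar 3))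
      (RNot (rfm_at p RZero k_rtm (RVar 3)))))"
    by (rule sat_from_int) (use k_gt_1 in \<open>auto simp: rsentence_def nonneg_t_int_iff\<close>)
  then show "nonneg_t i \<Longrightarrow> kpow p k i \<noteq> 0" using is_kpow_kpow by force
qed

lemma kpow_eq_1_imp: "nonneg_t m \<Longrightarrow> kpow p k m = (1 :: 'a) \<Longrightarrow> m = 0"
proof -
  have "n = 0" if "0 \<le> n" "k ^ nat n = 1" for n :: int
    using that one_less_power[OF k_gt_1, of "nat n"] by (cases "nat n = 0") auto
  then have "rfm_sat (\<lambda>_. 0 :: 'a) (rfm_all 3 (rfm_imp (rfm_nonneg (RVar 3))
      (rfm_imp (rfm_at p ROne k_rtm (RVar 3)) (REq (RVar 3) RZero))))"
    by (intro sat_from_int) (use k_gt_1 in \<open>auto simp: rsentence_def nonneg_t_int_iff\<close>)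
  then show "nonneg_t m \<Longrightarrow> kpow p k m = 1 \<Longrightarrow> m = 0" using is_kpow_kpow by force
qed

lemma kpow_minus_1_dvd:
  assumes "nonneg_t (s :: 'a)" "nonneg_t t"
  shows "kpow p k s - 1 dvd kpow p k (s * t) - 1"
proof -
  have int_case: "\<exists>q. q * k ^ nat s + 1 = k ^ nat (s * t) + q" if "0 \<le> s" "0 \<le> t" for s t :: int
  proof -
    have "k ^ nat (s * t) - 1 = (k ^ nat s - 1) * (\<Sum>i<nat t. (k ^ nat s) ^ i)"
      using that power_diff_1_eq[of "k ^ nat s" "nat t"] by (simp add: nat_mult_distrib power_mult)
    then show ?thesis by (intro exI[of _ "\<Sum>i<nat t. (k ^ nat s) ^ i"]) (simp add: algebra_simps)
  qed
  \<comment> \<open>\<open>x - 1 dvd y - 1\<close>, written without subtraction as \<open>\<exists>q. q x + 1 = y + q\<close>:\<close>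
  have "rfm_sat (\<lambda>_. 0 :: 'a) (rfm_all 3 (rfm_all 4 (rfm_imp (rfm_nonneg (RVar 3))
      (rfm_imp (rfm_nonneg (RVar 4)) (RExists 5 (RExists 6 (RExists 7
      (RAnd (rfm_at p (RVar 6) k_rtm (RVar 3))
      (RAnd (rfm_at p (RVar 7) k_rtm (RMul (RVar 3) (RVar 4)))
      (REq (RAdd (RMul (RVar 5) (RVar 6)) ROne) (RAdd (RVar 7) (RVar 5))))))))))))"
    by (intro sat_from_int) (use k_gt_1 in \<open>auto simp: rsentence_def nonneg_t_int_iff int_case\<close>)
  then obtain q where "q * kpow p k s + 1 = kpow p k (s * t) + q"
    using assms kpow_eqI by force
  then have "kpow p k (s * t) - 1 = (kpow p k s - 1) * q" by (simp add: algebra_simps)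
  then show ?thesis by simp
qed

lemma non_zero_divisor_kpow: "nonneg_t i \<Longrightarrow> non_zero_divisor (kpow p k i :: 'a)"
  unfolding non_zero_divisor_def using kpow_nonzero no_zero_divisors by blast

lemma tfract_no_zero_divisors: "(x :: 'a tfract) * y = 0 \<longleftrightarrow> x = 0 \<or> y = 0"
  by (rule tfract_mult_eq_0_iff) (rule no_zero_divisors)

section \<open>The ring \<open>\<int>\<^sup>~[1/k\<^sup>\<int>\<^sup>~]\<close> and geometric sums\<close>

text \<open>\<open>kfracs\<close> is the image of \<open>\<int>\<^sup>~[1/k\<^sup>\<int>\<^sup>~]\<close> in the total ring of fractions.\<close>
definition kfrac :: "'a \<Rightarrow> 'a \<Rightarrow> 'a tfract" where
  "kfrac a i = TFract a (kpow p k i)"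

definition kfracs :: "'a tfract set" where
  "kfracs = {kfrac a i | a i. nonneg_t i}"

lemma kfrac_eq_iff:
  "nonneg_t i \<Longrightarrow> nonneg_t j \<Longrightarrow> kfrac a i = kfrac b j \<longleftrightarrow> a * kpow p k j = b * kpow p k i"
  unfolding kfrac_def by (simp add: eq_tfract non_zero_divisor_kpow)

lemma kfrac_add:
  "nonneg_t i \<Longrightarrow> nonneg_t j \<Longrightarrow>
    kfrac a i + kfrac b j = kfrac (a * kpow p k j + b * kpow p k i) (i + j)"
  unfolding kfrac_def by (simp add: non_zero_divisor_kpow kpow_add)

lemma kfrac_mult: "nonneg_t i \<Longrightarrow> nonneg_t j \<Longrightarrow> kfrac a i * kfrac b j = kfrac (a * b) (i + j)"
  unfolding kfrac_def by (simp add: non_zero_divisor_kpow kpow_add)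

lemma kfrac_minus: "nonneg_t i \<Longrightarrow> - kfrac a i = kfrac (- a) i"
  unfolding kfrac_def by (simp add: non_zero_divisor_kpow)

lemma kfrac_zero_zero [simp]: "kfrac 0 0 = 0"
  unfolding kfrac_def by (simp add: Zero_tfract_def)

lemma kfrac_one_zero [simp]: "kfrac 1 0 = 1"
  unfolding kfrac_def by (simp add: One_tfract_def)

lemma one_minus_kfrac_one: "nonneg_t i \<Longrightarrow> 1 - kfrac 1 i = kfrac (kpow p k i - 1) i"
  unfolding kfrac_def One_tfract_def by (simp add: non_zero_divisor_kpow)

lemma kfrac_in_kfracs: "nonneg_t i \<Longrightarrow> kfrac a i \<in> kfracs"
  unfolding kfracs_def by blast

lemma kfracsE:
  assumes "x \<in> kfracs"
  obtains a i where "nonneg_t i" "x = kfrac a i"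
  using assms unfolding kfracs_def by blast

lemma kfracs_add: "x \<in> kfracs \<Longrightarrow> y \<in> kfracs \<Longrightarrow> x + y \<in> kfracs"
  by (auto elim!: kfracsE simp: kfrac_add intro!: kfrac_in_kfracs nonneg_t_add)

lemma kfracs_mult: "x \<in> kfracs \<Longrightarrow> y \<in> kfracs \<Longrightarrow> x * y \<in> kfracs"
  by (auto elim!: kfracsE simp: kfrac_mult intro!: kfrac_in_kfracs nonneg_t_add)

lemma kfracs_uminus: "x \<in> kfracs \<Longrightarrow> - x \<in> kfracs"
  by (auto elim!: kfracsE simp: kfrac_minus intro!: kfrac_in_kfracs)

lemma kfracs_diff: "x \<in> kfracs \<Longrightarrow> y \<in> kfracs \<Longrightarrow> x - y \<in> kfracs"
  unfolding diff_conv_add_uminus by (intro kfracs_add kfracs_uminus)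

lemma nonneg_t_diff_obtain:
  obtains a b :: 'a where "nonneg_t a" "nonneg_t b" "m = a - b"
proof (cases "nonneg_t m")
  case True
  then show ?thesis using that[of m 0] by simp
next
  case False
  then show ?thesis using that[of 0 "- m"] nonneg_t_cases[of m] by simp
qed

definition kinv_pow :: "'a \<Rightarrow> 'a tfract" where
  "kinv_pow m = (if nonneg_t m then kfrac 1 m else kfrac (kpow p k (- m)) 0)"

lemma kinv_pow_diff:
  assumes a: "nonneg_t a" and b: "nonneg_t b"
  shows "kinv_pow (a - b) = kfrac (kpow p k b) a"
proof (cases "nonneg_t (a - b)")
  case True
  then have "kpow p k a = kpow p k (a - b) * kpow p k b" using kpow_add[OF True b] by simp
  then show ?thesis using True a by (simp add: kinv_pow_def kfrac_eq_iff)
next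
  case False
  then have ba: "nonneg_t (b - a)" using nonneg_t_cases[of "a - b"] by simp
  then have "kpow p k b = kpow p k (b - a) * kpow p k a" using kpow_add[OF ba a] by simp
  then show ?thesis using False ba a by (simp add: kinv_pow_def kfrac_eq_iff)
qed

lemma kinv_pow_add: "kinv_pow (m + n) = kinv_pow m * kinv_pow n"
proof -
  obtain a b where ab: "nonneg_t a" "nonneg_t b" "m = a - b" by (rule nonneg_t_diff_obtain)
  obtain c d where cd: "nonneg_t c" "nonneg_t d" "n = c - d" by (rule nonneg_t_diff_obtain)
  have mn: "m + n = (a + c) - (b + d)" using ab cd by simp
  have "kinv_pow (m + n) = kfrac (kpow p k b * kpow p k d) (a + c)"
    unfolding mn using ab cd by (simp add: kinv_pow_diff nonneg_t_add kpow_add)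
  also have "\<dots> = kinv_pow m * kinv_pow n"
    using ab cd by (simp add: kinv_pow_diff kfrac_mult)
  finally show ?thesis .
qed

lemma kinv_pow_zero [simp]: "kinv_pow 0 = 1"
  by (simp add: kinv_pow_def)

lemma kinv_pow_neq_1: "m \<noteq> 0 \<Longrightarrow> kinv_pow m \<noteq> 1"
  using kpow_eq_1_imp[of m] kpow_eq_1_imp[of "- m"] nonneg_t_cases[of m]
  by (auto simp: kinv_pow_def kfrac_one_zero[symmetric] kfrac_eq_iff simp del: kfrac_one_zero)

lemma kinv_pow_in_kfracs: "kinv_pow m \<in> kfracs"
  using nonneg_t_cases[of m] by (auto simp: kinv_pow_def intro: kfrac_in_kfracs)

lemma one_in_kfracs: "1 \<in> kfracs"
  using kinv_pow_in_kfracs[of 0] by simp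

lemmas kfracs_closed =
  kfracs_add kfracs_mult kfracs_uminus kfracs_diff kinv_pow_in_kfracs one_in_kfracs

lemma one_minus_kinv_pow_cancel:
  assumes "m \<noteq> 0" and "x * (1 - kinv_pow m) = y * (1 - kinv_pow m)"
  shows "x = y"
proof -
  have "(x - y) * (1 - kinv_pow m) = 0" using assms(2) by (simp add: algebra_simps)
  then show ?thesis using kinv_pow_neq_1[OF assms(1)] by (simp add: tfract_no_zero_divisors)
qed

lemma one_minus_kinv_pow_uminus: "1 - kinv_pow (- m) = - kinv_pow (- m) * (1 - kinv_pow m)"
  using kinv_pow_add[of "- m" m] by (simp add: algebra_simps)

lemma geometric_in_kfracs_nonneg:
  assumes s: "nonneg_t s" and t: "nonneg_t t"
  shows "\<exists>z\<in>kfracs. z * (1 - kinv_pow s) = 1 - kinv_pow (s * t)"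
proof -
  obtain q where q: "kpow p k (s * t) - 1 = (kpow p k s - 1) * q"
    using kpow_minus_1_dvd[OF s t] by blast
  have st: "nonneg_t (s * t)" using nonneg_t_mult[OF s t] .
  have "kfrac (kpow p k s * q) (s * t) * (1 - kinv_pow s)
      = kfrac (kpow p k s * q * (kpow p k s - 1)) (s * t + s)"
    using s st by (simp add: kinv_pow_def one_minus_kfrac_one kfrac_mult)
  also have "\<dots> = kfrac (kpow p k (s * t) - 1) (s * t)"
    using s st by (simp add: kfrac_eq_iff kpow_add q algebra_simps nonneg_t_add)
  also have "\<dots> = 1 - kinv_pow (s * t)"
    using st by (simp add: kinv_pow_def one_minus_kfrac_one)
  finally show ?thesis using st by (blast intro: kfrac_in_kfracs)
qed

lemma geometric_in_kfracs: "\<exists>z\<in>kfracs. z * (1 - kinv_pow m) = 1 - kinv_pow (\<alpha> * m)"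
proof -
  have flip_num: "\<exists>z\<in>kfracs. z * d = 1 - kinv_pow (- n)"
    if "z \<in> kfracs" "z * d = 1 - kinv_pow n" for z d n
  proof
    show "- kinv_pow (- n) * z \<in> kfracs" using that by (intro kfracs_closed)
    have "- kinv_pow (- n) * z * d = - kinv_pow (- n) * (1 - kinv_pow n)"
      using that(2) by (simp add: mult.assoc)
    also have "\<dots> = 1 - kinv_pow (- n)" by (rule one_minus_kinv_pow_uminus[symmetric])
    finally show "- kinv_pow (- n) * z * d = 1 - kinv_pow (- n)" .
  qed
  have flip_den: "\<exists>z\<in>kfracs. z * (1 - kinv_pow (- n)) = e"
    if "z \<in> kfracs" "z * (1 - kinv_pow n) = e" for z n e
  proof
    show "- z * kinv_pow n \<in> kfracs" using that by (intro kfracs_closed)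
    have "- z * kinv_pow n * (1 - kinv_pow (- n))
        = (kinv_pow n * kinv_pow (- n)) * (z * (1 - kinv_pow n))"
      unfolding one_minus_kinv_pow_uminus[of n] by (simp add: algebra_simps)
    also have "\<dots> = e" using kinv_pow_add[of n "- n"] that(2) by simp
    finally show "- z * kinv_pow n * (1 - kinv_pow (- n)) = e" .
  qed
  obtain s t where s: "nonneg_t s" "m = s \<or> m = - s" and t: "nonneg_t t" "\<alpha> = t \<or> \<alpha> = - t"
    using nonneg_t_cases[of m] nonneg_t_cases[of \<alpha>] by (metis minus_minus)
  obtain z where z: "z \<in> kfracs" "z * (1 - kinv_pow s) = 1 - kinv_pow (s * t)"
    using geometric_in_kfracs_nonneg[OF s(1) t(1)] by blast
  have "\<alpha> * m = s * t \<or> \<alpha> * m = - (s * t)" using s(2) t(2) by (auto simp: mult.commute)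
  then have "\<exists>z\<in>kfracs. z * (1 - kinv_pow s) = 1 - kinv_pow (\<alpha> * m)"
    using z flip_num[OF z] by auto
  then show ?thesis using flip_den s(2) by auto
qed

text \<open>\<open>geom_sum m \<alpha> = (1 - k\<^sup>-\<^sup>\<alpha>\<^sup>m) / (1 - k\<^sup>-\<^sup>m)\<close>, which for natural \<open>\<alpha>\<close> is the geometric sum
  \<open>1 + k\<^sup>-\<^sup>m + \<dots> + k\<^sup>-\<^sup>(\<^sup>\<alpha>\<^sup>-\<^sup>1\<^sup>)\<^sup>m\<close>, and \<open>\<alpha>\<close> itself when \<open>m = 0\<close>. It is the first coordinate
  of \<open>(1, m)\<^sup>\<alpha>\<close> in \<open>BS(1, k, \<int>\<^sup>~)\<close>.\<close>
definition geom_sum :: "'a \<Rightarrow> 'a \<Rightarrow> 'a tfract" where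
  "geom_sum m \<alpha> =
    (if m = 0 then kfrac \<alpha> 0 else THE z. z * (1 - kinv_pow m) = 1 - kinv_pow (\<alpha> * m))"

lemma geom_sum_zero_left [simp]: "geom_sum 0 \<alpha> = kfrac \<alpha> 0"
  by (simp add: geom_sum_def)

lemma geom_sum_eqI:
  assumes "m \<noteq> 0" and "z * (1 - kinv_pow m) = 1 - kinv_pow (\<alpha> * m)"
  shows "geom_sum m \<alpha> = z"
  unfolding geom_sum_def using assms one_minus_kinv_pow_cancel
  by (auto intro!: the_equality)

lemma geom_sum_in_kfracs: "geom_sum m \<alpha> \<in> kfracs"
proof (cases "m = 0")
  case False
  then show ?thesis using geometric_in_kfracs[of m \<alpha>] geom_sum_eqI by force
qed (simp add: kfrac_in_kfracs)

lemma geom_sum_mult_one_minus: "geom_sum m \<alpha> * (1 - kinv_pow m) = 1 - kinv_pow (\<alpha> * m)"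
proof (cases "m = 0")
  case False
  then show ?thesis using geometric_in_kfracs[of m \<alpha>] geom_sum_eqI by force
qed simp

lemma geom_sum_one [simp]: "geom_sum m 1 = 1"
  by (cases "m = 0") (simp_all add: geom_sum_eqI)

lemma geom_sum_zero_right [simp]: "geom_sum m 0 = 0"
  by (cases "m = 0") (simp_all add: geom_sum_eqI)

lemma geom_sum_add: "geom_sum m (\<alpha> + \<beta>) = geom_sum m \<alpha> + kinv_pow (\<alpha> * m) * geom_sum m \<beta>"
proof (cases "m = 0")
  case True
  then show ?thesis by (simp add: kfrac_add)
next
  case False
  have "(geom_sum m \<alpha> + kinv_pow (\<alpha> * m) * geom_sum m \<beta>) * (1 - kinv_pow m)
      = geom_sum m \<alpha> * (1 - kinv_pow m) + kinv_pow (\<alpha> * m) * (geom_sum m \<beta> * (1 - kinv_pow m))"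
    by (simp add: algebra_simps)
  also have "\<dots> = (1 - kinv_pow (\<alpha> * m)) + kinv_pow (\<alpha> * m) * (1 - kinv_pow (\<beta> * m))"
    by (simp only: geom_sum_mult_one_minus)
  also have "\<dots> = 1 - kinv_pow ((\<alpha> + \<beta>) * m)"
    by (simp add: algebra_simps kinv_pow_add)
  finally show ?thesis by (intro geom_sum_eqI[OF False])
qed

lemma geom_sum_mult: "geom_sum m (\<alpha> * \<beta>) = geom_sum m \<alpha> * geom_sum (\<alpha> * m) \<beta>"
proof (cases "m = 0")
  case True
  then show ?thesis by (simp add: kfrac_mult)
next
  case False
  have "(geom_sum m \<alpha> * geom_sum (\<alpha> * m) \<beta>) * (1 - kinv_pow m)
      = geom_sum (\<alpha> * m) \<beta> * (geom_sum m \<alpha> * (1 - kinv_pow m))"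
    by (simp add: ac_simps)
  also have "\<dots> = 1 - kinv_pow (\<alpha> * \<beta> * m)"
    by (simp add: geom_sum_mult_one_minus ac_simps)
  finally show ?thesis by (intro geom_sum_eqI[OF False])
qed

text \<open>The case \<open>m \<noteq> 0\<close> is settled by multiplying by \<open>1 - k\<^sup>-\<^sup>m\<close>; for \<open>m = 0\<close> the
  hypothesis forces \<open>x = 0\<close> or \<open>n = 0\<close>.\<close>
lemma geom_sum_commute:
  assumes comm: "y * (1 - kinv_pow m) = x * (1 - kinv_pow n)"
  shows "geom_sum (m + n) \<alpha> * (x + kinv_pow m * y)
    = geom_sum m \<alpha> * x + kinv_pow (\<alpha> * m) * (geom_sum n \<alpha> * y)"
proof (cases "m = 0")
  case True
  then have "x * (1 - kinv_pow n) = 0" using comm by simp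
  then have "x = 0 \<or> n = 0" using kinv_pow_neq_1 by (auto simp: tfract_no_zero_divisors)
  then show ?thesis using True by (auto simp: algebra_simps)
next
  case False
  have "geom_sum (m + n) \<alpha> * (x + kinv_pow m * y) * (1 - kinv_pow m)
      = geom_sum (m + n) \<alpha> * (x * (1 - kinv_pow m) + kinv_pow m * (y * (1 - kinv_pow m)))"
    by (simp add: algebra_simps)
  also have "\<dots> = geom_sum (m + n) \<alpha> * (1 - kinv_pow (m + n)) * x"
    unfolding comm by (simp add: algebra_simps kinv_pow_add)
  also have "\<dots> = (1 - kinv_pow (\<alpha> * m) * kinv_pow (\<alpha> * n)) * x"
    by (simp only: geom_sum_mult_one_minus) (simp add: distrib_left kinv_pow_add)
  also have "\<dots> = (geom_sum m \<alpha> * (1 - kinv_pow m)) * x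
      + kinv_pow (\<alpha> * m) * (geom_sum n \<alpha> * (1 - kinv_pow n)) * x"
    by (simp only: geom_sum_mult_one_minus) (simp add: algebra_simps)
  also have "\<dots> = geom_sum m \<alpha> * (1 - kinv_pow m) * x
      + kinv_pow (\<alpha> * m) * geom_sum n \<alpha> * (y * (1 - kinv_pow m))"
    unfolding comm by (simp add: algebra_simps)
  also have "\<dots> = (geom_sum m \<alpha> * x + kinv_pow (\<alpha> * m) * (geom_sum n \<alpha> * y)) * (1 - kinv_pow m)"
    by (simp add: algebra_simps)
  finally show ?thesis by (rule one_minus_kinv_pow_cancel[OF False])
qed

lemma geom_sum_conj:
  "geom_sum m \<alpha> * (u * (x - y + kinv_pow m * y))
    = u * (geom_sum m \<alpha> * x - y + kinv_pow (\<alpha> * m) * y)"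
proof -
  have "geom_sum m \<alpha> * (u * (x - y + kinv_pow m * y))
      = u * (geom_sum m \<alpha> * x - (geom_sum m \<alpha> * (1 - kinv_pow m)) * y)"
    by (simp add: algebra_simps)
  then show ?thesis unfolding geom_sum_mult_one_minus by (simp add: algebra_simps)
qed

section \<open>Exponentiation in \<open>BS(1, k, \<int>\<^sup>~)\<close>\<close>

definition reps :: "'a tfract \<Rightarrow> ('a \<times> 'a) set" where
  "reps y = {r \<in> frac_reps. kfrac (fst r) (snd r) = y}"

lemma mem_reps_iff [simp]: "(a, i) \<in> reps y \<longleftrightarrow> nonneg_t i \<and> kfrac a i = y"
  by (simp add: reps_def frac_reps_def)

lemma reps_subset: "reps y \<subseteq> frac_reps"
  by (auto simp: reps_def)

lemma frac_rel_iff: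
  assumes "nonneg_t i" "nonneg_t j"
  shows "frac_rel p k (a, i) (b, j) \<longleftrightarrow> kfrac a i = kfrac b j"
proof -
  have "frac_rel p k (a, i) (b, j) \<longleftrightarrow> a * kpow p k j - b * kpow p k i = 0"
    unfolding frac_rel_def by (auto dest!: no_zero_divisors simp: kpow_nonzero intro!: exI[of _ 0])
  then show ?thesis using assms by (simp add: kfrac_eq_iff)
qed

lemma frac_class_eq: "nonneg_t i \<Longrightarrow> frac_class p k (a, i) = reps (kfrac a i)"
  unfolding frac_class_def reps_def frac_reps_def by (auto simp: frac_rel_iff)

lemma fracs_eq: "fracs p k = reps ` kfracs"
proof -
  have "fracs p k = (\<lambda>(a, i). reps (kfrac a i)) ` frac_reps"
    unfolding fracs_def by (intro image_cong) (auto simp: frac_reps_def frac_class_eq)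
  also have "\<dots> = reps ` kfracs"
    unfolding kfracs_def frac_reps_def by auto
  finally show ?thesis .
qed

lemma inj_on_reps: "inj_on reps kfracs"
proof (rule inj_onI)
  fix x y assume "x \<in> kfracs" "y \<in> kfracs" "reps x = reps y"
  then show "x = y" by (metis kfracsE mem_reps_iff)
qed

lemma frac_add_reps:
  assumes x: "x \<in> kfracs" and y: "y \<in> kfracs"
  shows "frac_add p k (reps x) (reps y) = reps (x + y)"
proof -
  have key: "frac_rel p k (a * kpow p k j + b * kpow p k i, i + j) r \<longleftrightarrow> r \<in> reps (x + y)"
    if "(a, i) \<in> reps x" "(b, j) \<in> reps y" "r \<in> frac_reps" for a i b j r
    using that by (cases r) (auto simp: frac_reps_def frac_rel_iff kfrac_add nonneg_t_add)
  obtain a i where "(a, i) \<in> reps x" using x by (auto elim: kfracsE)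
  moreover obtain b j where "(b, j) \<in> reps y" using y by (auto elim: kfracsE)
  ultimately show ?thesis
    unfolding frac_add_def using key reps_subset by blast
qed

lemma frac_scale_reps:
  assumes x: "x \<in> kfracs"
  shows "frac_scale p k m (reps x) = reps (kinv_pow m * x)"
proof -
  have key: "(if nonneg_t m then frac_rel p k (a, i + m) r
      else frac_rel p k (a * kpow p k (- m), i) r) \<longleftrightarrow> r \<in> reps (kinv_pow m * x)"
    if "(a, i) \<in> reps x" "r \<in> frac_reps" for a i r
    using that nonneg_t_cases[of m]
    by (cases r)
      (auto simp: frac_reps_def frac_rel_iff kinv_pow_def kfrac_mult nonneg_t_add ac_simps)
  obtain a i where "(a, i) \<in> reps x" using x by (auto elim: kfracsE)
  then show ?thesis
    unfolding frac_scale_def using key reps_subset by blast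
qed

lemma BS_carrier: "carrier (BS p k) = reps ` kfracs \<times> UNIV"
  by (simp add: BS_def fracs_eq)

lemma BS_carrierE:
  assumes "g \<in> carrier (BS p k)"
  obtains x m where "x \<in> kfracs" "g = (reps x, m)"
  using assms unfolding BS_carrier by blast

lemma BS_carrierI: "x \<in> kfracs \<Longrightarrow> (reps x, m) \<in> carrier (BS p k)"
  unfolding BS_carrier by blast

lemma BS_mult_reps:
  "x \<in> kfracs \<Longrightarrow> y \<in> kfracs \<Longrightarrow>
    (reps x, m) \<otimes>\<^bsub>BS p k\<^esub> (reps y, n) = (reps (x + kinv_pow m * y), m + n)"
  unfolding BS_def by (simp add: frac_scale_reps frac_add_reps kfracs_closed)

lemma BS_one: "\<one>\<^bsub>BS p k\<^esub> = (reps 0, 0)"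
  unfolding BS_def using frac_class_eq[of 0 0] by simp

lemma group_BS: "group (BS p k :: (('a \<times> 'a) set \<times> 'a) monoid)"
proof (rule groupI)
  show "\<one>\<^bsub>BS p k\<^esub> \<in> carrier (BS p k :: (('a \<times> 'a) set \<times> 'a) monoid)"
    unfolding BS_one using kfrac_in_kfracs[of 0 0] by (auto intro: BS_carrierI)
next
  fix g h f :: "('a \<times> 'a) set \<times> 'a"
  assume "g \<in> carrier (BS p k)" "h \<in> carrier (BS p k)" "f \<in> carrier (BS p k)"
  then show "g \<otimes>\<^bsub>BS p k\<^esub> h \<otimes>\<^bsub>BS p k\<^esub> f = g \<otimes>\<^bsub>BS p k\<^esub> (h \<otimes>\<^bsub>BS p k\<^esub> f)"
    by (auto elim!: BS_carrierE simp: BS_mult_reps kfracs_closed kinv_pow_add algebra_simps)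
next
  fix g h :: "('a \<times> 'a) set \<times> 'a"
  assume "g \<in> carrier (BS p k)" "h \<in> carrier (BS p k)"
  then show "g \<otimes>\<^bsub>BS p k\<^esub> h \<in> carrier (BS p k)"
    by (auto elim!: BS_carrierE simp: BS_mult_reps intro!: BS_carrierI kfracs_closed)
next
  fix g :: "('a \<times> 'a) set \<times> 'a"
  assume "g \<in> carrier (BS p k)"
  then obtain x m where x: "x \<in> kfracs" "g = (reps x, m)" by (rule BS_carrierE)
  then show "\<one>\<^bsub>BS p k\<^esub> \<otimes>\<^bsub>BS p k\<^esub> g = g"
    using kfrac_in_kfracs[of 0 0] by (simp add: BS_one BS_mult_reps)
  have "(reps (- (kinv_pow (- m) * x)), - m) \<otimes>\<^bsub>BS p k\<^esub> g = \<one>\<^bsub>BS p k\<^esub>"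
    using x by (simp add: BS_mult_reps BS_one kfracs_closed)
  moreover have "(reps (- (kinv_pow (- m) * x)), - m) \<in> carrier (BS p k)"
    using x by (intro BS_carrierI kfracs_closed)
  ultimately show "\<exists>y\<in>carrier (BS p k). y \<otimes>\<^bsub>BS p k\<^esub> g = \<one>\<^bsub>BS p k\<^esub>" by blast
qed

lemma BS_inv_reps:
  assumes "x \<in> kfracs"
  shows "inv\<^bsub>BS p k\<^esub> (reps x, m) = (reps (- (kinv_pow (- m) * x)), - m)"
proof -
  have "(reps (- (kinv_pow (- m) * x)), - m) \<otimes>\<^bsub>BS p k\<^esub> (reps x, m) = \<one>\<^bsub>BS p k\<^esub>"
    using assms by (simp add: BS_mult_reps BS_one kfracs_closed)
  then show ?thesis
    using assms by (simp add: group.inv_equality[OF group_BS] BS_carrierI kfracs_closed)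
qed

lemma BS_conj_reps:
  assumes x: "x \<in> kfracs" and z: "z \<in> kfracs"
  shows "inv\<^bsub>BS p k\<^esub> (reps z, n) \<otimes>\<^bsub>BS p k\<^esub> (reps x, m) \<otimes>\<^bsub>BS p k\<^esub> (reps z, n)
    = (reps (kinv_pow (- n) * (x - z + kinv_pow m * z)), m)"
proof -
  have "inv\<^bsub>BS p k\<^esub> (reps z, n) \<otimes>\<^bsub>BS p k\<^esub> (reps x, m) \<otimes>\<^bsub>BS p k\<^esub> (reps z, n)
      = (reps (- (kinv_pow (- n) * z) + kinv_pow (- n) * x + kinv_pow (- n + m) * z), - n + m + n)"
    using x z by (simp add: BS_inv_reps BS_mult_reps kfracs_closed)
  also have "\<dots> = (reps (kinv_pow (- n) * (x - z + kinv_pow m * z)), m)"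
    unfolding kinv_pow_add[of "- n" m] by (simp add: algebra_simps)
  finally show ?thesis .
qed

lemma BS_commute_reps:
  assumes "x \<in> kfracs" "y \<in> kfracs"
    and "(reps x, m) \<otimes>\<^bsub>BS p k\<^esub> (reps y, n) = (reps y, n) \<otimes>\<^bsub>BS p k\<^esub> (reps x, m)"
  shows "y * (1 - kinv_pow m) = x * (1 - kinv_pow n)"
proof -
  have "reps (x + kinv_pow m * y) = reps (y + kinv_pow n * x)"
    using assms by (simp add: BS_mult_reps)
  then have "x + kinv_pow m * y = y + kinv_pow n * x"
    using assms(1,2) by (intro inj_onD[OF inj_on_reps]) (simp_all add: kfracs_closed)
  then show ?thesis by (simp add: algebra_simps)
qed

text \<open>\<open>(x, m)\<^sup>\<alpha> = (geom_sum m \<alpha> \<cdot> x, \<alpha> m)\<close>, read through the bijection \<open>reps\<close>.\<close>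
definition BS_pow :: "('a \<times> 'a) set \<times> 'a \<Rightarrow> 'a \<Rightarrow> ('a \<times> 'a) set \<times> 'a" where
  "BS_pow g \<alpha> = (reps (geom_sum (snd g) \<alpha> * the_inv_into kfracs reps (fst g)), \<alpha> * snd g)"

lemma BS_pow_reps: "x \<in> kfracs \<Longrightarrow> BS_pow (reps x, m) \<alpha> = (reps (geom_sum m \<alpha> * x), \<alpha> * m)"
  by (simp add: BS_pow_def the_inv_into_f_f[OF inj_on_reps])

lemma ring_exp_group_BS: "ring_exp_group (BS p k) BS_pow"
  unfolding ring_exp_group_def
proof (intro conjI ballI allI impI)
  show "group (BS p k :: (('a \<times> 'a) set \<times> 'a) monoid)" by (rule group_BS)
  have "0 \<in> kfracs" using kfrac_in_kfracs[of 0 0] by simp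
  then show "BS_pow \<one>\<^bsub>BS p k\<^esub> \<alpha> = \<one>\<^bsub>BS p k\<^esub>" for \<alpha>
    by (simp add: BS_one BS_pow_reps)
  fix g :: "('a \<times> 'a) set \<times> 'a" assume "g \<in> carrier (BS p k)"
  then obtain x m where x: "x \<in> kfracs" and g: "g = (reps x, m)" by (rule BS_carrierE)
  show "BS_pow g \<alpha> \<in> carrier (BS p k)" for \<alpha>
    using x unfolding g by (simp add: BS_pow_reps BS_carrierI kfracs_closed geom_sum_in_kfracs)
  show "BS_pow g 1 = g" using x unfolding g by (simp add: BS_pow_reps)
  show "BS_pow g 0 = \<one>\<^bsub>BS p k\<^esub>" using x unfolding g by (simp add: BS_pow_reps BS_one)
  show "BS_pow g (\<alpha> + \<beta>) = BS_pow g \<alpha> \<otimes>\<^bsub>BS p k\<^esub> BS_pow g \<beta>" for \<alpha> \<beta>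
    using x unfolding g
    by (simp add: BS_pow_reps BS_mult_reps kfracs_closed geom_sum_in_kfracs geom_sum_add
        algebra_simps)
  show "BS_pow g (\<alpha> * \<beta>) = BS_pow (BS_pow g \<alpha>) \<beta>" for \<alpha> \<beta>
    using x unfolding g
    by (simp add: BS_pow_reps kfracs_closed geom_sum_in_kfracs geom_sum_mult ac_simps)
  fix h :: "('a \<times> 'a) set \<times> 'a" and \<alpha> :: 'a assume "h \<in> carrier (BS p k)"
  then obtain y n where y: "y \<in> kfracs" and h: "h = (reps y, n)" by (rule BS_carrierE)
  show "BS_pow (inv\<^bsub>BS p k\<^esub> h \<otimes>\<^bsub>BS p k\<^esub> g \<otimes>\<^bsub>BS p k\<^esub> h) \<alpha>
      = inv\<^bsub>BS p k\<^esub> h \<otimes>\<^bsub>BS p k\<^esub> BS_pow g \<alpha> \<otimes>\<^bsub>BS p k\<^esub> h"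
    using x y unfolding g h
    by (simp add: BS_conj_reps BS_pow_reps kfracs_closed geom_sum_in_kfracs geom_sum_conj)
  assume "g \<otimes>\<^bsub>BS p k\<^esub> h = h \<otimes>\<^bsub>BS p k\<^esub> g"
  then have "y * (1 - kinv_pow m) = x * (1 - kinv_pow n)"
    unfolding g h by (rule BS_commute_reps[OF x y])
  then have "geom_sum (m + n) \<alpha> * (x + kinv_pow m * y)
      = geom_sum m \<alpha> * x + kinv_pow (\<alpha> * m) * (geom_sum n \<alpha> * y)"
    by (rule geom_sum_commute)
  moreover have "\<alpha> * (m + n) = \<alpha> * m + \<alpha> * n" by (rule distrib_left)
  ultimately show "BS_pow (g \<otimes>\<^bsub>BS p k\<^esub> h) \<alpha> = BS_pow g \<alpha> \<otimes>\<^bsub>BS p k\<^esub> BS_pow h \<alpha>"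
    using x y unfolding g h
    by (simp add: BS_mult_reps BS_pow_reps kfracs_closed geom_sum_in_kfracs)
qed

end

theorem theorem5p2:
  fixes k :: int and p :: rfm
  assumes "k > 1"
    and "elem_equiv_Z TYPE('a::comm_ring_1)"
    and "defines_exp_Z p"
  shows "\<exists>pw :: ('a \<times> 'a) set \<times> 'a \<Rightarrow> 'a \<Rightarrow> ('a \<times> 'a) set \<times> 'a.
           ring_exp_group (BS p k) pw"
  using ring_exp_group_BS[OF assms] by blast

end
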